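(* Let $t$ be a complex number. For any two sequences of complex numbers $\{a_n\}_{n\ge 1}$ and $\{b_n\}_{n\ge 1}$ the following two conditions are equivalent: $$a_n=n\sum_{m=1}^n\binom{mt}{n-m}b_m\quad\text{for all } n\ge 1$$ and $$b_n=\frac 1n\sum_{m=1}^{n}\binom{-nt}{n-m}a_m\quad\text{for all } n\ge 1.$$
   Context: Binomial coefficients are generalized: for any complex number $z$ and integer $j\ge 0$, $\binom{z}{j}=\frac{z(z-1)\cdots(z-j+1)}{j!}$ (with $\binom z0=1$). *)

theory Defs
  imports Complex_Main
begin

end

theory Submission
  imports Defs "HOL-Computational_Algebra.Formal_Power_Series"
begin

text \<open>
  Both conditions say that a lower triangular matrix maps one sequence to the other. By the
  Vandermonde convolution and the absorption identity
  $j \binom{kt}{j} = kt \binom{kt-1}{j-1}$, one matrix is a left inverse of the other. A triangular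
  matrix with nonzero diagonal is injective, so the left inverse is also a right inverse.
\<close>

text \<open>The term for \<open>j = 0\<close> vanishes; in the others absorption trades the weight
  \<open>j\<close> for the constant factor \<open>y\<close>, and what is left is a Vandermonde
  convolution.\<close>

lemma gchoose_weighted_convolution:
  fixes x y :: "'a::field_char_0"
  shows "(\<Sum>j\<le>Suc N. (x gchoose (Suc N - j)) * (of_nat j * (y gchoose j))) = y * ((x + y - 1) gchoose N)"
proof -
  have "(\<Sum>j\<le>Suc N. (x gchoose (Suc N - j)) * (of_nat j * (y gchoose j)))
      = (\<Sum>j\<le>N. (x gchoose (N - j)) * (of_nat (Suc j) * (y gchoose Suc j)))"
    by (subst sum.atMost_Suc_shift) simp
  also have "\<dots> = y * (\<Sum>j\<le>N. ((y - 1) gchoose j) * (x gchoose (N - j)))"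
    unfolding gbinomial_absorption sum_distrib_left by (intro sum.cong) (simp_all add: mult_ac)
  also have "(\<Sum>j\<le>N. ((y - 1) gchoose j) * (x gchoose (N - j))) = (x + y - 1) gchoose N"
    using gbinomial_Vandermonde[of "y - 1" x N] by (simp add: atLeast0AtMost algebra_simps)
  finally show ?thesis .
qed

text \<open>For \<open>k < n\<close>, splitting the weight as \<open>m = k + (m - k)\<close> gives a
  plain and a weighted Vandermonde convolution, which evaluate to opposite multiples of the same
  binomial coefficient.\<close>

lemma gchoose_orthogonality:
  fixes t :: "'a::field_char_0"
  assumes "k \<le> n"
  shows "(\<Sum>m=k..n. ((- of_nat n * t) gchoose (n - m)) * (of_nat m * ((of_nat k * t) gchoose (m - k))))
       = (if k = n then of_nat n else 0)"
proof (cases "k = n")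
  case False
  then obtain N where n: "n = k + Suc N"
    using assms by (metis less_iff_Suc_add le_neq_implies_less add_Suc_right)
  define x y where "x = - of_nat n * t" and "y = of_nat k * t"
  \<comment> \<open>The cancellation rests on this: \<open>x + y\<close> is \<open>- t\<close> times
    the lower index \<open>Suc N\<close>, so absorption will pull out exactly the factor
    \<open>- t\<close>.\<close>
  have xy: "x + y = - of_nat (Suc N) * t"
    by (simp add: x_def y_def n algebra_simps)
  have "(\<Sum>m=k..n. (x gchoose (n - m)) * (of_nat m * (y gchoose (m - k))))
      = (\<Sum>j\<le>Suc N. (x gchoose (Suc N - j)) * (of_nat (k + j) * (y gchoose j)))"
    unfolding sum.atLeastAtMost_shift_0[OF assms] by (intro sum.cong) (auto simp: n)
  also have "\<dots> = of_nat k * (\<Sum>j\<le>Suc N. (y gchoose j) * (x gchoose (Suc N - j)))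
      + (\<Sum>j\<le>Suc N. (x gchoose (Suc N - j)) * (of_nat j * (y gchoose j)))"
    unfolding sum_distrib_left sum.distrib[symmetric] by (intro sum.cong) (simp_all add: algebra_simps)
  also have "(\<Sum>j\<le>Suc N. (y gchoose j) * (x gchoose (Suc N - j))) = (x + y) gchoose Suc N"
    using gbinomial_Vandermonde[of y x "Suc N"] by (simp only: atLeast0AtMost add.commute)
  also have "\<dots> = - t * ((x + y - 1) gchoose N)"
  proof -
    have "of_nat (Suc N) * ((x + y) gchoose Suc N) = of_nat (Suc N) * (- t * ((x + y - 1) gchoose N))"
      unfolding gbinomial_absorption by (simp add: xy algebra_simps)
    then show ?thesis
      by (simp only: mult_cancel_left of_nat_neq_0 simp_thms)
  qed
  \<comment> \<open>The weighted sum contributes the factor \<open>y = of_nat k * t\<close>,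
    opposite to \<open>of_nat k * (- t)\<close>.\<close>
  also have "of_nat k * (- t * ((x + y - 1) gchoose N))
      + (\<Sum>j\<le>Suc N. (x gchoose (Suc N - j)) * (of_nat j * (y gchoose j))) = 0"
    unfolding gchoose_weighted_convolution by (simp add: y_def)
  finally show ?thesis
    using False by (simp only: x_def y_def if_False)
qed simp

text \<open>Forward substitution: once all earlier entries agree, the equation at \<open>n\<close>
  reduces to its diagonal term, where \<open>c n n\<close> cancels.\<close>

lemma triangular_sum_inject:
  fixes c :: "nat \<Rightarrow> nat \<Rightarrow> 'a::idom"
  assumes diag: "\<And>n. n \<ge> l \<Longrightarrow> c n n \<noteq> 0"
    and eq: "\<And>n. n \<ge> l \<Longrightarrow> (\<Sum>m=l..n. c n m * u m) = (\<Sum>m=l..n. c n m * v m)"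
    and "n \<ge> l"
  shows "u n = v n"
  using \<open>n \<ge> l\<close>
proof (induction n rule: less_induct)
  case (less n)
  have split: "{l..n} = insert n {l..<n}"
    using less.prems by auto
  have "(\<Sum>m=l..<n. c n m * u m) = (\<Sum>m=l..<n. c n m * v m)"
    using less.IH by (intro sum.cong) auto
  then show ?case
    using eq[OF less.prems] diag[OF less.prems] by (simp add: split)
qed

text \<open>Exchanging the sums over the triangle \<open>1 \<le> k \<le> m \<le> n\<close> makes the
  orthogonality sum the coefficient of \<open>b k\<close>, so only \<open>k = n\<close>
  survives.\<close>

lemma gchoose_inversion:
  fixes t :: "'a::field_char_0" and b :: "nat \<Rightarrow> 'a"
  shows "(\<Sum>m=1..n. ((- of_nat n * t) gchoose (n - m))
            * (of_nat m * (\<Sum>k=1..m. ((of_nat k * t) gchoose (m - k)) * b k))) = of_nat n * b n"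
proof -
  let ?f = "\<lambda>m k. ((- of_nat n * t) gchoose (n - m)) * (of_nat m * ((of_nat k * t) gchoose (m - k)))"
  have "(\<Sum>m=1..n. ((- of_nat n * t) gchoose (n - m))
            * (of_nat m * (\<Sum>k=1..m. ((of_nat k * t) gchoose (m - k)) * b k)))
      = (\<Sum>m=1..n. \<Sum>k | k \<in> {1..n} \<and> k \<le> m. ?f m k * b k)"
    unfolding sum_distrib_left by (intro sum.cong) (auto simp: mult_ac)
  also have "\<dots> = (\<Sum>k=1..n. \<Sum>m | m \<in> {1..n} \<and> k \<le> m. ?f m k * b k)"
    by (rule sum.swap_restrict) simp_all
  also have "\<dots> = (\<Sum>k=1..n. (\<Sum>m=k..n. ?f m k) * b k)"
    unfolding sum_distrib_right by (intro sum.cong) auto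
  also have "\<dots> = (\<Sum>k=1..n. (if k = n then of_nat n else 0) * b k)"
    by (intro sum.cong refl arg_cong2[where f = "(*)"] gchoose_orthogonality) simp
  also have "\<dots> = of_nat n * b n"
    by (cases "n = 0") (simp_all add: if_distrib[of "\<lambda>z. z * _"] sum.delta cong: if_cong)
  finally show ?thesis .
qed

theorem theorem3p3:
  fixes t :: complex and a b :: "nat \<Rightarrow> complex"
  shows "(\<forall>n\<ge>1. a n = of_nat n * (\<Sum>m=1..n. ((of_nat m * t) gchoose (n - m)) * b m))
     \<longleftrightarrow> (\<forall>n\<ge>1. b n = 1 / of_nat n * (\<Sum>m=1..n. ((- of_nat n * t) gchoose (n - m)) * a m))"
proof -
  \<comment> \<open>\<open>a'\<close> is the sequence that the first condition prescribes for
    \<open>a\<close>; both conditions become statements comparing \<open>a\<close> with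
    \<open>a'\<close>.\<close>
  define a' where "a' n = of_nat n * (\<Sum>m=1..n. ((of_nat m * t) gchoose (n - m)) * b m)" for n
  define c where "c n m = (- of_nat n * t) gchoose (n - m)" for n m
  have inv: "(\<Sum>m=1..n. c n m * a' m) = of_nat n * b n" for n
    unfolding c_def a'_def by (rule gchoose_inversion)
  have "(\<forall>n\<ge>1. a n = a' n) \<longleftrightarrow> (\<forall>n\<ge>1. (\<Sum>m=1..n. c n m * a m) = (\<Sum>m=1..n. c n m * a' m))"
  proof
    assume "\<forall>n\<ge>1. a n = a' n"
    then show "\<forall>n\<ge>1. (\<Sum>m=1..n. c n m * a m) = (\<Sum>m=1..n. c n m * a' m)"
      by (auto intro!: sum.cong)
  next
    assume "\<forall>n\<ge>1. (\<Sum>m=1..n. c n m * a m) = (\<Sum>m=1..n. c n m * a' m)"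
    then show "\<forall>n\<ge>1. a n = a' n"
      \<comment> \<open>The diagonal entries \<open>c n n\<close> have lower index 0 and thus equal
        1.\<close>
      using triangular_sum_inject[of 1 c a a'] by (simp add: c_def)
  qed
  \<comment> \<open>By \<open>inv\<close> the image of \<open>a'\<close> under \<open>c\<close> is
    \<open>of_nat n * b n\<close>, and \<open>n \<ge> 1\<close> permits dividing by
    \<open>n\<close>.\<close>
  also have "\<dots> \<longleftrightarrow> (\<forall>n\<ge>1. b n = 1 / of_nat n * (\<Sum>m=1..n. c n m * a m))"
    unfolding inv by (auto simp: field_simps)
  finally show ?thesis
    unfolding a'_def c_def .
qed

end
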